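(* Let $(\boldsymbol{x},\boldsymbol{n},\boldsymbol{s}):U\to\mathbb{R}^3\times\Delta$ be a framed surface with basic invariants $a_i,b_i,e_i,f_i,g_i$ ($i=1,2$). Then $(\boldsymbol{x},\boldsymbol{n},\boldsymbol{s})$ is an $(\boldsymbol{n},\overline{\boldsymbol{s}})$-Bertrand framed surface if and only if there exist smooth functions $\lambda,\theta:U\to\mathbb{R}$ with $\lambda\not\equiv0$ such that $$\begin{pmatrix} a_1(u,v)+\lambda(u,v)e_1(u,v) & b_1(u,v)+\lambda(u,v)f_1(u,v)\\ a_2(u,v)+\lambda(u,v)e_2(u,v) & b_2(u,v)+\lambda(u,v)f_2(u,v)\end{pmatrix}\begin{pmatrix}\sin\theta(u,v)\\ \cos\theta(u,v)\end{pmatrix}=\begin{pmatrix}0\\0\end{pmatrix}$$ for all $(u,v)\in U$.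
   Context: All maps are $C^\infty$. $U\subset\mathbb{R}^2$ is a simply connected domain with coordinates $(u,v)$, $S^2$ is the unit sphere in $\mathbb{R}^3$, and $\Delta=\{(\boldsymbol{a},\boldsymbol{b})\in S^2\times S^2 : \boldsymbol{a}\cdot\boldsymbol{b}=0\}$. A framed surface is a smooth map $(\boldsymbol{x},\boldsymbol{n},\boldsymbol{s}):U\to\mathbb{R}^3\times\Delta$ with $\boldsymbol{x}_u\cdot\boldsymbol{n}=\boldsymbol{x}_v\cdot\boldsymbol{n}=0$ on $U$. Put $\boldsymbol{t}=\boldsymbol{n}\times\boldsymbol{s}$. Its basic invariants are the smooth functions $a_i,b_i,e_i,f_i,g_i:U\to\mathbb{R}$ ($i=1,2$) determined by $\boldsymbol{x}_u=a_1\boldsymbol{s}+b_1\boldsymbol{t}$, $\boldsymbol{n}_u=e_1\boldsymbol{s}+f_1\boldsymbol{t}$, $\boldsymbol{s}_u=-e_1\boldsymbol{n}+g_1\boldsymbol{t}$, $\boldsymbol{t}_u=-f_1\boldsymbol{n}-g_1\boldsymbol{s}$, and the same equations with $\partial_v$ in place of $\partial_u$ and index $2$ in place of $1$. For a smooth $\lambda:U\to\mathbb{R}$, $\lambda\not\equiv0$ means that $\{(u,v)\in U:\lambda(u,v)\neq0\}$ is dense in $U$. Two framed surfaces $(\boldsymbol{x},\boldsymbol{n},\boldsymbol{s}),(\overline{\boldsymbol{x}},\overline{\boldsymbol{n}},\overline{\boldsymbol{s}}):U\to\mathbb{R}^3\times\Delta$ (with $\overline{\boldsymbol{t}}=\overline{\boldsymbol{n}}\times\overline{\boldsymbol{s}}$)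 are $(\boldsymbol{v},\overline{\boldsymbol{w}})$-mates, where each of $\boldsymbol{v},\boldsymbol{w}$ is one of $\boldsymbol{n},\boldsymbol{s},\boldsymbol{t}$, if there is a smooth $\lambda:U\to\mathbb{R}$ with $\lambda\not\equiv0$ such that $\overline{\boldsymbol{x}}=\boldsymbol{x}+\lambda\boldsymbol{v}$ and $\boldsymbol{v}=\overline{\boldsymbol{w}}$ on $U$. $(\boldsymbol{x},\boldsymbol{n},\boldsymbol{s})$ is a $(\boldsymbol{v},\overline{\boldsymbol{w}})$-Bertrand framed surface if there is a framed surface $(\overline{\boldsymbol{x}},\overline{\boldsymbol{n}},\overline{\boldsymbol{s}}):U\to\mathbb{R}^3\times\Delta$ such that the two are $(\boldsymbol{v},\overline{\boldsymbol{w}})$-mates. *)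

theory Defs
  imports "HOL-Analysis.Analysis"
begin

(* Order-k continuous differentiability, and smoothness, of a map between finite-dimensional
   spaces on an open set S.  The derivative is taken at (at x) and not at (at x within S), so
   S must be open for this to depend only on the values of f on S. *)
primrec higher_differentiable_on ::
    "'a::euclidean_space set \<Rightarrow> ('a \<Rightarrow> 'b::euclidean_space) \<Rightarrow> nat \<Rightarrow> bool" where
  "higher_differentiable_on S f 0 \<longleftrightarrow> continuous_on S f"
| "higher_differentiable_on S f (Suc k) \<longleftrightarrow>
     (\<forall>x\<in>S. f differentiable (at x)) \<and>
     (\<forall>w. higher_differentiable_on S (\<lambda>x. frechet_derivative f (at x) w) k)"

definition smooth_on ::
    "'a::euclidean_space set \<Rightarrow> ('a \<Rightarrow> 'b::euclidean_space) \<Rightarrow> bool" where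
  "smooth_on S f \<longleftrightarrow> (\<forall>k. higher_differentiable_on S f k)"

definition partial_u :: "(real \<times> real \<Rightarrow> 'a::euclidean_space) \<Rightarrow> real \<times> real \<Rightarrow> 'a" where
  "partial_u f p = vector_derivative (\<lambda>h. f (h, snd p)) (at (fst p))"

definition partial_v :: "(real \<times> real \<Rightarrow> 'a::euclidean_space) \<Rightarrow> real \<times> real \<Rightarrow> 'a" where
  "partial_v f p = vector_derivative (\<lambda>h. f (fst p, h)) (at (snd p))"

definition simply_connected_domain :: "(real \<times> real) set \<Rightarrow> bool" where
  "simply_connected_domain U \<longleftrightarrow> open U \<and> U \<noteq> {} \<and> simply_connected U"

definition Delta :: "((real^3) \<times> (real^3)) set" where
  "Delta = {(a, b). a \<in> sphere 0 1 \<and> b \<in> sphere 0 1 \<and> a \<bullet> b = 0}"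

(* Surfaces are total functions of which only the values on U are relevant. *)
definition framed_surface ::
    "(real \<times> real) set \<Rightarrow> (real \<times> real \<Rightarrow> real^3) \<Rightarrow> (real \<times> real \<Rightarrow> real^3) \<Rightarrow>
     (real \<times> real \<Rightarrow> real^3) \<Rightarrow> bool" where
  "framed_surface U x n s \<longleftrightarrow>
     smooth_on U (\<lambda>p. (x p, n p, s p)) \<and>
     (\<forall>p\<in>U. (n p, s p) \<in> Delta) \<and>
     (\<forall>p\<in>U. partial_u x p \<bullet> n p = 0 \<and> partial_v x p \<bullet> n p = 0)"

definition frame_t ::
    "(real \<times> real \<Rightarrow> real^3) \<Rightarrow> (real \<times> real \<Rightarrow> real^3) \<Rightarrow> real \<times> real \<Rightarrow> real^3" where
  "frame_t n s p = cross3 (n p) (s p)"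

(* D stands for one of the two partial derivative operators. *)
definition structure_equations ::
    "((real \<times> real \<Rightarrow> real^3) \<Rightarrow> real \<times> real \<Rightarrow> real^3) \<Rightarrow> (real \<times> real) set \<Rightarrow>
     (real \<times> real \<Rightarrow> real^3) \<Rightarrow> (real \<times> real \<Rightarrow> real^3) \<Rightarrow> (real \<times> real \<Rightarrow> real^3) \<Rightarrow>
     (real \<times> real \<Rightarrow> real) \<Rightarrow> (real \<times> real \<Rightarrow> real) \<Rightarrow> (real \<times> real \<Rightarrow> real) \<Rightarrow>
     (real \<times> real \<Rightarrow> real) \<Rightarrow> (real \<times> real \<Rightarrow> real) \<Rightarrow> bool" where
  "structure_equations D U x n s a b e f g \<longleftrightarrow>
     (\<forall>p\<in>U.
        D x p = a p *\<^sub>R s p + b p *\<^sub>R frame_t n s p \<and>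
        D n p = e p *\<^sub>R s p + f p *\<^sub>R frame_t n s p \<and>
        D s p = - e p *\<^sub>R n p + g p *\<^sub>R frame_t n s p \<and>
        D (frame_t n s) p = - f p *\<^sub>R n p - g p *\<^sub>R s p)"

definition basic_invariants ::
    "(real \<times> real) set \<Rightarrow>
     (real \<times> real \<Rightarrow> real^3) \<Rightarrow> (real \<times> real \<Rightarrow> real^3) \<Rightarrow> (real \<times> real \<Rightarrow> real^3) \<Rightarrow>
     (real \<times> real \<Rightarrow> real) \<Rightarrow> (real \<times> real \<Rightarrow> real) \<Rightarrow> (real \<times> real \<Rightarrow> real) \<Rightarrow>
     (real \<times> real \<Rightarrow> real) \<Rightarrow> (real \<times> real \<Rightarrow> real) \<Rightarrow>
     (real \<times> real \<Rightarrow> real) \<Rightarrow> (real \<times> real \<Rightarrow> real) \<Rightarrow> (real \<times> real \<Rightarrow> real) \<Rightarrow>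
     (real \<times> real \<Rightarrow> real) \<Rightarrow> (real \<times> real \<Rightarrow> real) \<Rightarrow> bool" where
  "basic_invariants U x n s a1 b1 e1 f1 g1 a2 b2 e2 f2 g2 \<longleftrightarrow>
     (\<forall>h \<in> {a1, b1, e1, f1, g1, a2, b2, e2, f2, g2}. smooth_on U h) \<and>
     structure_equations partial_u U x n s a1 b1 e1 f1 g1 \<and>
     structure_equations partial_v U x n s a2 b2 e2 f2 g2"

(* The relation written as an identity with 0 crossed out: non-vanishing on a dense subset of U,
   not merely at some point. *)
definition not_equiv_zero :: "(real \<times> real) set \<Rightarrow> (real \<times> real \<Rightarrow> real) \<Rightarrow> bool" where
  "not_equiv_zero U l \<longleftrightarrow> U \<subseteq> closure {p \<in> U. l p \<noteq> 0}"

datatype frame_label = Label_n | Label_s | Label_t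

fun frame_vector ::
    "frame_label \<Rightarrow> (real \<times> real \<Rightarrow> real^3) \<Rightarrow> (real \<times> real \<Rightarrow> real^3) \<Rightarrow>
     real \<times> real \<Rightarrow> real^3" where
  "frame_vector Label_n n s = n"
| "frame_vector Label_s n s = s"
| "frame_vector Label_t n s = frame_t n s"

(* The first label selects v from the frame of the first surface, the second label selects w-bar
   from the frame of the second surface. *)
definition mates ::
    "frame_label \<Rightarrow> frame_label \<Rightarrow> (real \<times> real) set \<Rightarrow>
     (real \<times> real \<Rightarrow> real^3) \<Rightarrow> (real \<times> real \<Rightarrow> real^3) \<Rightarrow> (real \<times> real \<Rightarrow> real^3) \<Rightarrow>
     (real \<times> real \<Rightarrow> real^3) \<Rightarrow> (real \<times> real \<Rightarrow> real^3) \<Rightarrow> (real \<times> real \<Rightarrow> real^3) \<Rightarrow> bool" where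
  "mates V W U x n s x' n' s' \<longleftrightarrow>
     framed_surface U x n s \<and> framed_surface U x' n' s' \<and>
     (\<exists>l. smooth_on U l \<and> not_equiv_zero U l \<and>
        (\<forall>p\<in>U. x' p = x p + l p *\<^sub>R frame_vector V n s p \<and>
                frame_vector V n s p = frame_vector W n' s' p))"

definition bertrand_framed_surface ::
    "frame_label \<Rightarrow> frame_label \<Rightarrow> (real \<times> real) set \<Rightarrow>
     (real \<times> real \<Rightarrow> real^3) \<Rightarrow> (real \<times> real \<Rightarrow> real^3) \<Rightarrow> (real \<times> real \<Rightarrow> real^3) \<Rightarrow> bool" where
  "bertrand_framed_surface V W U x n s \<longleftrightarrow>
     (\<exists>x' n' s'. framed_surface U x' n' s' \<and> mates V W U x n s x' n' s')"

end

theory Submission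
  imports Defs
begin

text \<open>
  Write \<open>t = n \<times> s\<close>.  For a surface \<open>y = x + l n\<close> displaced along the normal and a vector field
  \<open>m\<close> orthogonal to \<open>n\<close>, the terms \<open>l\<^sub>u n\<close> drop out of \<open>y\<^sub>u \<bullet> m\<close>, and what remains is
  \<open>(a\<^sub>1 + l e\<^sub>1) (s \<bullet> m) + (b\<^sub>1 + l f\<^sub>1) (t \<bullet> m)\<close>, with the corresponding formula for \<open>v\<close>
  (lemma \<open>tangency_row\<close>).  So the matrix equation of the theorem says exactly that \<open>m\<close> with frame
  coordinates \<open>(sin \<theta>, cos \<theta>)\<close> is normal to \<open>y\<close>.

  Given \<open>l\<close> and \<open>\<theta>\<close>, the mate is therefore \<open>y\<close> with normal \<open>sin \<theta> s + cos \<theta> t\<close> and second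
  frame vector \<open>n\<close>.

  Conversely, the normal \<open>m\<close> of a mate is a unit vector orthogonal to \<open>n\<close>, so that
  \<open>(s \<bullet> m, t \<bullet> m)\<close> is a smooth map from \<open>U\<close> to the unit circle.  Because \<open>U\<close> is simply connected,
  this map has a continuous angle function (a continuous logarithm).  The angle is smooth, since
  locally it is an arcsine of a smooth function (lemma \<open>smooth_angle\<close>); this is the only place
  where simple connectedness enters.

  The remaining work is the calculus of smooth maps in terms of iterated Frechet derivatives:
  closure under bounded linear and bilinear maps, sums, sine and cosine.
\<close>

section \<open>Calculus of smooth maps\<close>

lemma higher_differentiable_on_cong:
  assumes "open S" "\<And>x. x \<in> S \<Longrightarrow> f x = g x" "higher_differentiable_on S f k"
  shows "higher_differentiable_on S g k"
  using assms(2,3)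
proof (induction k arbitrary: f g)
  case 0
  then show ?case by (simp cong: continuous_on_cong)
next
  case (Suc k)
  have diff: "f differentiable (at x)" if "x \<in> S" for x
    using Suc.prems(2) that by simp
  have "g differentiable (at x)" if "x \<in> S" for x
  proof -
    obtain D where "(f has_derivative D) (at x)"
      using diff[OF \<open>x \<in> S\<close>] unfolding differentiable_def by blast
    then have "(g has_derivative D) (at x)"
      by (rule has_derivative_transform_within_open[OF _ assms(1) \<open>x \<in> S\<close>]) (rule Suc.prems(1))
    then show ?thesis unfolding differentiable_def by blast
  qed
  moreover have "higher_differentiable_on S (\<lambda>x. frechet_derivative g (at x) w) k" for w
  proof (rule Suc.IH)
    show "higher_differentiable_on S (\<lambda>x. frechet_derivative f (at x) w) k"
      using Suc.prems(2) by simp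
    show "frechet_derivative f (at x) w = frechet_derivative g (at x) w" if "x \<in> S" for x
      using frechet_derivative_transform_within_open[OF diff[OF that] assms(1) that Suc.prems(1)]
      by simp
  qed
  ultimately show ?case by simp
qed

lemma higher_differentiable_on_SucD:
  "higher_differentiable_on S f (Suc k) \<Longrightarrow> higher_differentiable_on S f k"
proof (induction k arbitrary: f)
  case 0
  then show ?case
    by (auto intro!: continuous_at_imp_continuous_on differentiable_imp_continuous_within)
next
  case (Suc k)
  have "higher_differentiable_on S (\<lambda>x. frechet_derivative f (at x) w) k" for w
    using Suc.prems by (intro Suc.IH) simp
  then show ?case using Suc.prems by simp
qed

text \<open>Frechet derivatives are hard to compute as values of the choice operator.  With this rule the
  inductions on the order below can use any explicit formula for the derivative instead.\<close>

lemma higher_differentiable_on_SucI: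
  assumes "open S" "\<And>x. x \<in> S \<Longrightarrow> (f has_derivative f' x) (at x)"
    and "\<And>w. higher_differentiable_on S (\<lambda>x. f' x w) k"
  shows "higher_differentiable_on S f (Suc k)"
proof -
  have "higher_differentiable_on S (\<lambda>x. frechet_derivative f (at x) w) k" for w
    by (rule higher_differentiable_on_cong[OF assms(1) _ assms(3)[of w]])
       (metis assms(2) frechet_derivative_at)
  then show ?thesis using assms(2) by (auto simp: differentiable_def)
qed

lemma higher_differentiable_on_derivative:
  "higher_differentiable_on S f (Suc k) \<Longrightarrow> x \<in> S \<Longrightarrow>
    (f has_derivative frechet_derivative f (at x)) (at x)"
  by (simp flip: frechet_derivative_works)

lemma higher_differentiable_on_bounded_linear:
  assumes "open S" "bounded_linear h" "higher_differentiable_on S f k"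
  shows "higher_differentiable_on S (\<lambda>x. h (f x)) k"
  using assms(3)
proof (induction k arbitrary: f)
  case 0
  then show ?case by (simp add: bounded_linear.continuous_on[OF assms(2)])
next
  case (Suc k)
  show ?case
  proof (rule higher_differentiable_on_SucI[OF assms(1)])
    show "((\<lambda>x. h (f x)) has_derivative (\<lambda>w. h (frechet_derivative f (at x) w))) (at x)"
      if "x \<in> S" for x
      by (rule bounded_linear.has_derivative[OF assms(2)
            higher_differentiable_on_derivative[OF Suc.prems that]])
    show "higher_differentiable_on S (\<lambda>x. h (frechet_derivative f (at x) w)) k" for w
      using Suc.prems by (intro Suc.IH) simp
  qed
qed

lemma higher_differentiable_on_add:
  assumes "open S" "higher_differentiable_on S f k" "higher_differentiable_on S g k"
  shows "higher_differentiable_on S (\<lambda>x. f x + g x) k"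
  using assms(2,3)
proof (induction k arbitrary: f g)
  case 0
  then show ?case by (simp add: continuous_on_add)
next
  case (Suc k)
  show ?case
  proof (rule higher_differentiable_on_SucI[OF assms(1)])
    show "((\<lambda>x. f x + g x) has_derivative
        (\<lambda>w. frechet_derivative f (at x) w + frechet_derivative g (at x) w)) (at x)"
      if "x \<in> S" for x
      by (intro has_derivative_add higher_differentiable_on_derivative[OF Suc.prems(1) that]
            higher_differentiable_on_derivative[OF Suc.prems(2) that])
    show "higher_differentiable_on S
        (\<lambda>x. frechet_derivative f (at x) w + frechet_derivative g (at x) w) k" for w
      using Suc.prems by (intro Suc.IH) simp_all
  qed
qed

lemma higher_differentiable_on_bounded_bilinear:
  assumes "open S" "bounded_bilinear h"
    and "higher_differentiable_on S f k" "higher_differentiable_on S g k"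
  shows "higher_differentiable_on S (\<lambda>x. h (f x) (g x)) k"
  using assms(3,4)
proof (induction k arbitrary: f g)
  case 0
  then show ?case by (simp add: bounded_bilinear.continuous_on[OF assms(2)])
next
  case (Suc k)
  show ?case
  proof (rule higher_differentiable_on_SucI[OF assms(1)])
    show "((\<lambda>x. h (f x) (g x)) has_derivative
        (\<lambda>w. h (f x) (frechet_derivative g (at x) w) + h (frechet_derivative f (at x) w) (g x)))
        (at x)" if "x \<in> S" for x
      by (rule bounded_bilinear.FDERIV[OF assms(2)
            higher_differentiable_on_derivative[OF Suc.prems(1) that]
            higher_differentiable_on_derivative[OF Suc.prems(2) that]])
    show "higher_differentiable_on S (\<lambda>x. h (f x) (frechet_derivative g (at x) w)
        + h (frechet_derivative f (at x) w) (g x)) k" for w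
      using Suc.prems higher_differentiable_on_SucD[OF Suc.prems(1)]
        higher_differentiable_on_SucD[OF Suc.prems(2)]
      by (intro higher_differentiable_on_add[OF assms(1)] Suc.IH) simp_all
  qed
qed

text \<open>Sine and cosine need a joint induction, each being the derivative of the other up to sign.\<close>

lemma higher_differentiable_on_sin_cos:
  fixes f :: "'a::euclidean_space \<Rightarrow> real"
  assumes "open S" "higher_differentiable_on S f k"
  shows "higher_differentiable_on S (\<lambda>x. sin (f x)) k \<and> higher_differentiable_on S (\<lambda>x. cos (f x)) k"
  using assms(2)
proof (induction k)
  case 0
  then show ?case by (auto intro: continuous_on_sin continuous_on_cos)
next
  case (Suc k)
  note der = higher_differentiable_on_derivative[OF Suc.prems]
  note IH = Suc.IH[OF higher_differentiable_on_SucD[OF Suc.prems]]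
  have df: "higher_differentiable_on S (\<lambda>x. frechet_derivative f (at x) w) k" for w
    using Suc.prems by simp
  note mult = higher_differentiable_on_bounded_bilinear[OF assms(1) bounded_bilinear_mult]
  show ?case
  proof (intro conjI; rule higher_differentiable_on_SucI[OF assms(1)])
    show "((\<lambda>x. sin (f x)) has_derivative (\<lambda>w. cos (f x) * frechet_derivative f (at x) w)) (at x)"
      if "x \<in> S" for x
      using der[OF that] by (auto intro!: derivative_eq_intros)
    show "higher_differentiable_on S (\<lambda>x. cos (f x) * frechet_derivative f (at x) w) k" for w
      using IH df by (intro mult) auto
    show "((\<lambda>x. cos (f x)) has_derivative (\<lambda>w. - (sin (f x) * frechet_derivative f (at x) w))) (at x)"
      if "x \<in> S" for x
      using der[OF that] by (auto intro!: derivative_eq_intros)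
    show "higher_differentiable_on S (\<lambda>x. - (sin (f x) * frechet_derivative f (at x) w)) k" for w
      using IH df
      by (intro higher_differentiable_on_bounded_linear[OF assms(1), where h = uminus]
            bounded_linear_minus bounded_linear_ident mult) blast+
  qed
qed

lemma smooth_on_bounded_linear:
  "open S \<Longrightarrow> bounded_linear h \<Longrightarrow> smooth_on S f \<Longrightarrow> smooth_on S (\<lambda>x. h (f x))"
  by (simp add: smooth_on_def higher_differentiable_on_bounded_linear)

lemma smooth_on_add:
  "open S \<Longrightarrow> smooth_on S f \<Longrightarrow> smooth_on S g \<Longrightarrow> smooth_on S (\<lambda>x. f x + g x)"
  by (simp add: smooth_on_def higher_differentiable_on_add)

lemma smooth_on_bounded_bilinear:
  "open S \<Longrightarrow> bounded_bilinear h \<Longrightarrow> smooth_on S f \<Longrightarrow> smooth_on S g \<Longrightarrow>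
    smooth_on S (\<lambda>x. h (f x) (g x))"
  by (simp add: smooth_on_def higher_differentiable_on_bounded_bilinear)

lemmas smooth_on_scaleR = smooth_on_bounded_bilinear[OF _ bounded_bilinear_scaleR]
lemmas smooth_on_inner = smooth_on_bounded_bilinear[OF _ bounded_bilinear_inner]
lemmas smooth_on_cross3 =
  smooth_on_bounded_bilinear[OF _ bilinear_cross[unfolded bilinear_conv_bounded_bilinear]]

lemma smooth_on_sin_cos:
  fixes f :: "'a::euclidean_space \<Rightarrow> real"
  assumes "open S" "smooth_on S f"
  shows "smooth_on S (\<lambda>x. sin (f x))" "smooth_on S (\<lambda>x. cos (f x))"
  using assms by (simp_all add: smooth_on_def higher_differentiable_on_sin_cos)

lemma smooth_on_Pair:
  assumes "open S" "smooth_on S f" "smooth_on S g"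
  shows "smooth_on S (\<lambda>x. (f x, g x))"
proof -
  have "smooth_on S (\<lambda>x. (f x, 0) + (0, g x))"
    using assms
    by (intro smooth_on_add smooth_on_bounded_linear[where h = "\<lambda>y. (y, 0)"]
          smooth_on_bounded_linear[where h = "\<lambda>y. (0, y)"]
          bounded_linear_Pair bounded_linear_ident bounded_linear_zero)
  then show ?thesis by simp
qed

lemma smooth_on_has_derivative:
  assumes "smooth_on S f" "x \<in> S"
  shows "(f has_derivative frechet_derivative f (at x)) (at x)"
  using assms higher_differentiable_on_derivative[of S f 0] unfolding smooth_on_def by blast

section \<open>Smooth angle functions\<close>

text \<open>Near \<open>x\<close> the angle difference \<open>\<theta> y - \<theta> x\<close> is small by continuity, hence it is the arcsine of
  its sine \<open>p y q x - q y p x\<close>, which depends differentiably on \<open>y\<close>.\<close>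

lemma angle_has_derivative:
  fixes \<theta> p q :: "'a::real_normed_vector \<Rightarrow> real"
  assumes "open S" "x \<in> S" "continuous_on S \<theta>"
    and sc: "\<And>y. y \<in> S \<Longrightarrow> p y = sin (\<theta> y) \<and> q y = cos (\<theta> y)"
    and dp: "(p has_derivative p') (at x)" and dq: "(q has_derivative q') (at x)"
  shows "(\<theta> has_derivative (\<lambda>w. q x * p' w - p x * q' w)) (at x)"
proof -
  define T where "T = S \<inter> \<theta> -` {\<theta> x - pi/2 <..< \<theta> x + pi/2}"
  have "open T"
    unfolding T_def using assms(1,3) by (intro continuous_open_preimage) auto
  have "x \<in> T" using assms(2) pi_gt_zero by (simp add: T_def)
  have "((\<lambda>y. \<theta> x + arcsin (p y * q x - q y * p x)) has_derivative
      (\<lambda>w. q x * p' w - p x * q' w)) (at x)"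
    by (rule derivative_eq_intros dp dq | simp add: algebra_simps)+
  moreover have "\<theta> x + arcsin (p y * q x - q y * p x) = \<theta> y" if "y \<in> T" for y
  proof -
    have "p y * q x - q y * p x = sin (\<theta> y - \<theta> x)"
      using that assms(2) by (simp add: T_def sc sin_diff)
    moreover have "- (pi/2) \<le> \<theta> y - \<theta> x" "\<theta> y - \<theta> x \<le> pi/2"
      using that by (auto simp: T_def)
    ultimately show ?thesis by (simp add: arcsin_sin)
  qed
  ultimately show ?thesis
    using has_derivative_transform_within_open[OF _ \<open>open T\<close> \<open>x \<in> T\<close>] by blast
qed

text \<open>A continuous angle comes from a continuous logarithm of \<open>q + \<i> p\<close>.  Its derivative
  \<open>q dp - p dq\<close> does not mention the angle itself, so it is smooth at once and no induction on the
  order is needed.\<close>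

lemma smooth_angle:
  fixes p q :: "'a::euclidean_space \<Rightarrow> real"
  assumes "open S" "simply_connected S" "smooth_on S p" "smooth_on S q"
    and unit: "\<And>x. x \<in> S \<Longrightarrow> (p x)\<^sup>2 + (q x)\<^sup>2 = 1"
  obtains \<theta> where "smooth_on S \<theta>" "\<And>x. x \<in> S \<Longrightarrow> p x = sin (\<theta> x) \<and> q x = cos (\<theta> x)"
proof -
  have cont: "continuous_on S p" "continuous_on S q"
    using assms(3,4) unfolding smooth_on_def by (metis higher_differentiable_on.simps(1))+
  have nz: "Complex (q x) (p x) \<noteq> 0" if "x \<in> S" for x
    using unit[OF that] by (auto simp: complex_eq_iff)
  obtain g where g: "continuous_on S g" "\<And>x. x \<in> S \<Longrightarrow> Complex (q x) (p x) = exp (g x)"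
  proof (rule continuous_logarithm_on_simply_connected[of S "\<lambda>x. Complex (q x) (p x)"])
    show "continuous_on S (\<lambda>x. Complex (q x) (p x))"
      by (intro continuous_on_Complex cont)
  qed (use assms(1,2) nz in \<open>auto simp: open_imp_locally_path_connected\<close>)
  define \<theta> where "\<theta> x = Im (g x)" for x
  have cont\<theta>: "continuous_on S \<theta>"
    unfolding \<theta>_def by (intro continuous_intros g)
  have sc: "p x = sin (\<theta> x) \<and> q x = cos (\<theta> x)" if "x \<in> S" for x
  proof -
    have "exp (Re (g x)) = norm (Complex (q x) (p x))"
      by (simp add: g(2)[OF that])
    also have "\<dots> = 1"
      using unit[OF that] by (simp add: complex_norm add.commute)
    finally have "exp (Re (g x)) = 1" .
    moreover have "q x = Re (exp (g x))" "p x = Im (exp (g x))"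
      using g(2)[OF that] by (metis complex.sel)+
    ultimately show ?thesis
      by (simp add: \<theta>_def Re_exp Im_exp)
  qed
  have "higher_differentiable_on S \<theta> k" for k
  proof (cases k)
    case 0
    then show ?thesis using cont\<theta> by simp
  next
    case (Suc j)
    have d: "higher_differentiable_on S (\<lambda>x. frechet_derivative p (at x) w) j"
            "higher_differentiable_on S (\<lambda>x. frechet_derivative q (at x) w) j" for w
      using assms(3,4) higher_differentiable_on.simps(2) unfolding smooth_on_def by blast+
    have pq: "higher_differentiable_on S p j" "higher_differentiable_on S q j"
      using assms(3,4) unfolding smooth_on_def by blast+
    show ?thesis
      unfolding Suc
    proof (rule higher_differentiable_on_SucI[OF assms(1)])
      show "(\<theta> has_derivative (\<lambda>w. q x * frechet_derivative p (at x) w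
          + - (p x * frechet_derivative q (at x) w))) (at x)" if "x \<in> S" for x
        using angle_has_derivative[OF assms(1) that cont\<theta> sc
            smooth_on_has_derivative[OF assms(3) that] smooth_on_has_derivative[OF assms(4) that]]
        by simp
      show "higher_differentiable_on S (\<lambda>x. q x * frechet_derivative p (at x) w
          + - (p x * frechet_derivative q (at x) w)) j" for w
        using d pq assms(1)
        by (intro higher_differentiable_on_add
              higher_differentiable_on_bounded_linear[where h = uminus]
              higher_differentiable_on_bounded_bilinear[OF _ bounded_bilinear_mult]
              bounded_linear_minus bounded_linear_ident)
    qed
  qed
  then show ?thesis using sc that unfolding smooth_on_def by blast
qed

section \<open>Partial derivatives of a displaced surface\<close>

lemma partial_u_eq:
  assumes "(f has_derivative f') (at p)"
  shows "partial_u f p = f' (1, 0)"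
proof -
  have "((\<lambda>h. (h, snd p)) has_derivative (\<lambda>h. (h, 0))) (at (fst p))"
    by (auto intro!: derivative_eq_intros)
  then have "((\<lambda>h. f (h, snd p)) has_derivative (\<lambda>h. f' (h, 0))) (at (fst p))"
    using has_derivative_compose[of "\<lambda>h. (h, snd p)" _ "fst p" UNIV f f'] assms by simp
  moreover have "(\<lambda>h. f' (h, 0)) = (\<lambda>h. h *\<^sub>R f' (1, 0))"
  proof
    fix h
    show "f' (h, 0) = h *\<^sub>R f' (1, 0)"
      using linear_scale[OF has_derivative_linear[OF assms], of h "(1, 0)"] by simp
  qed
  ultimately show ?thesis
    unfolding partial_u_def
    by (intro vector_derivative_at, unfold has_vector_derivative_def) (rule has_derivative_eq_rhs)
qed

lemma partial_v_eq:
  assumes "(f has_derivative f') (at p)"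
  shows "partial_v f p = f' (0, 1)"
proof -
  have "((\<lambda>h. (fst p, h)) has_derivative (\<lambda>h. (0, h))) (at (snd p))"
    by (auto intro!: derivative_eq_intros)
  then have "((\<lambda>h. f (fst p, h)) has_derivative (\<lambda>h. f' (0, h))) (at (snd p))"
    using has_derivative_compose[of "\<lambda>h. (fst p, h)" _ "snd p" UNIV f f'] assms by simp
  moreover have "(\<lambda>h. f' (0, h)) = (\<lambda>h. h *\<^sub>R f' (0, 1))"
  proof
    fix h
    show "f' (0, h) = h *\<^sub>R f' (0, 1)"
      using linear_scale[OF has_derivative_linear[OF assms], of h "(0, 1)"] by simp
  qed
  ultimately show ?thesis
    unfolding partial_v_def
    by (intro vector_derivative_at, unfold has_vector_derivative_def) (rule has_derivative_eq_rhs)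
qed

lemma partial_displaced:
  assumes "open U" "p \<in> U" "smooth_on U x" "smooth_on U n" "smooth_on U l"
    and y: "\<And>q. q \<in> U \<Longrightarrow> y q = x q + l q *\<^sub>R n q"
  shows "partial_u y p = partial_u x p + (l p *\<^sub>R partial_u n p + partial_u l p *\<^sub>R n p)"
    and "partial_v y p = partial_v x p + (l p *\<^sub>R partial_v n p + partial_v l p *\<^sub>R n p)"
proof -
  note dx = smooth_on_has_derivative[OF assms(3,2)]
  note dn = smooth_on_has_derivative[OF assms(4,2)]
  note dl = smooth_on_has_derivative[OF assms(5,2)]
  have "((\<lambda>q. x q + l q *\<^sub>R n q) has_derivative (\<lambda>w. frechet_derivative x (at p) w
      + (l p *\<^sub>R frechet_derivative n (at p) w + frechet_derivative l (at p) w *\<^sub>R n p))) (at p)"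
    by (intro has_derivative_add has_derivative_scaleR dx dn dl)
  then have dy: "(y has_derivative (\<lambda>w. frechet_derivative x (at p) w
      + (l p *\<^sub>R frechet_derivative n (at p) w + frechet_derivative l (at p) w *\<^sub>R n p))) (at p)"
    by (rule has_derivative_transform_within_open[OF _ assms(1,2)]) (simp add: y)
  show "partial_u y p = partial_u x p + (l p *\<^sub>R partial_u n p + partial_u l p *\<^sub>R n p)"
    by (simp add: partial_u_eq[OF dx] partial_u_eq[OF dn] partial_u_eq[OF dl] partial_u_eq[OF dy])
  show "partial_v y p = partial_v x p + (l p *\<^sub>R partial_v n p + partial_v l p *\<^sub>R n p)"
    by (simp add: partial_v_eq[OF dx] partial_v_eq[OF dn] partial_v_eq[OF dl] partial_v_eq[OF dy])
qed

text \<open>One row of the matrix equation, in either coordinate direction: the left-hand side is the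
  inner product of a derivative of the displaced surface with \<open>m\<close>, where \<open>m\<close> will be the normal of
  the mate.\<close>

lemma tangency_row:
  fixes m n s t :: "'a::real_inner"
  assumes "m \<bullet> n = 0"
  shows "((a *\<^sub>R s + b *\<^sub>R t) + (l *\<^sub>R (e *\<^sub>R s + f *\<^sub>R t) + d *\<^sub>R n)) \<bullet> m =
    (a + l * e) * (s \<bullet> m) + (b + l * f) * (t \<bullet> m)"
  using assms by (simp add: inner_add_left inner_commute[of m n] algebra_simps)

section \<open>The moving frame\<close>

lemma Delta_orthonormal:
  assumes "(a, b) \<in> Delta"
  shows "a \<bullet> a = 1" "b \<bullet> b = 1" "a \<bullet> b = 0"
    "cross3 a b \<bullet> cross3 a b = 1" "cross3 a b \<bullet> a = 0" "cross3 a b \<bullet> b = 0"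
proof -
  show 1: "a \<bullet> a = 1" "b \<bullet> b = 1" "a \<bullet> b = 0"
    using assms by (auto simp: Delta_def norm_eq_1)
  have "(norm (cross3 a b))\<^sup>2 = 1"
    using norm_cross_dot[of a b] 1 by (simp add: norm_eq_1[symmetric])
  then show "cross3 a b \<bullet> cross3 a b = 1"
    by (simp add: power2_norm_eq_inner)
  show "cross3 a b \<bullet> a = 0" "cross3 a b \<bullet> b = 0"
    by (simp_all add: dot_cross_self inner_commute)
qed

text \<open>The remainder \<open>r = m - (b \<bullet> m) b - (t \<bullet> m) t\<close> with \<open>t = a \<times> b\<close> is orthogonal to \<open>a\<close>, \<open>b\<close>
  and \<open>t\<close>.  By the Lagrange identity \<open>r \<times> t = (r \<bullet> b) a - (r \<bullet> a) b\<close> it is also parallel to the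
  unit vector \<open>t\<close>, so it vanishes.\<close>

lemma Delta_coordinates_unit:
  assumes "(a, b) \<in> Delta" "m \<bullet> a = 0" "m \<bullet> m = 1"
  shows "(b \<bullet> m)\<^sup>2 + (cross3 a b \<bullet> m)\<^sup>2 = 1"
proof -
  note on = Delta_orthonormal[OF assms(1)]
  define t where "t = cross3 a b"
  define r where "r = m - (b \<bullet> m) *\<^sub>R b - (t \<bullet> m) *\<^sub>R t"
  have ra: "r \<bullet> a = 0" and rb: "r \<bullet> b = 0" and rt: "r \<bullet> t = 0"
    using on assms(2) unfolding r_def t_def
    by (simp_all add: inner_diff_left inner_diff_right inner_commute)
  have "cross3 r t = (r \<bullet> b) *\<^sub>R a - (r \<bullet> a) *\<^sub>R b"
    unfolding t_def by (rule Lagrange)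
  then have "cross3 r t = 0"
    by (simp add: ra rb)
  then have "(norm r * norm t)\<^sup>2 = 0"
    using norm_cross_dot[of r t] rt by simp
  then have "r = 0"
    using on(4) by (auto simp: t_def)
  then have m: "m = (b \<bullet> m) *\<^sub>R b + (t \<bullet> m) *\<^sub>R t"
    by (simp add: r_def algebra_simps)
  have "1 = ((b \<bullet> m) *\<^sub>R b + (t \<bullet> m) *\<^sub>R t) \<bullet> m"
    using assms(3) m by simp
  then show ?thesis
    by (simp add: inner_add_left power2_eq_square t_def)
qed

lemma framed_surface_smooth:
  assumes "open U" "framed_surface U x n s"
  shows "smooth_on U x" "smooth_on U n" "smooth_on U s" "smooth_on U (frame_t n s)"
proof -
  have *: "smooth_on U (\<lambda>p. (x p, n p, s p))"
    using assms(2) by (simp add: framed_surface_def)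
  show "smooth_on U x"
    using smooth_on_bounded_linear[OF assms(1) bounded_linear_fst *] by simp
  have ns: "smooth_on U (\<lambda>p. (n p, s p))"
    using smooth_on_bounded_linear[OF assms(1) bounded_linear_snd *] by simp
  show n: "smooth_on U n"
    using smooth_on_bounded_linear[OF assms(1) bounded_linear_fst ns] by simp
  show s: "smooth_on U s"
    using smooth_on_bounded_linear[OF assms(1) bounded_linear_snd ns] by simp
  show "smooth_on U (frame_t n s)"
    unfolding frame_t_def by (rule smooth_on_cross3[OF assms(1) n s])
qed

lemma matrix_2_mult_eq_0_iff:
  fixes a b c d y z :: real
  shows "(vector [vector [a, b], vector [c, d]] :: real^2^2) *v vector [y, z] = 0 \<longleftrightarrow>
    a * y + b * z = 0 \<and> c * y + d * z = 0"
  by (simp add: vec_eq_iff forall_2 matrix_vector_mult_def sum_2)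

section \<open>Characterisation of Bertrand framed surfaces\<close>

theorem theorem3p6:
  fixes U :: "(real \<times> real) set"
    and x n s :: "real \<times> real \<Rightarrow> real^3"
    and a1 b1 e1 f1 g1 a2 b2 e2 f2 g2 :: "real \<times> real \<Rightarrow> real"
  assumes "simply_connected_domain U"
    and "framed_surface U x n s"
    and "basic_invariants U x n s a1 b1 e1 f1 g1 a2 b2 e2 f2 g2"
  shows "bertrand_framed_surface Label_n Label_s U x n s \<longleftrightarrow>
    (\<exists>l \<theta> :: real \<times> real \<Rightarrow> real.
       smooth_on U l \<and> smooth_on U \<theta> \<and> not_equiv_zero U l \<and>
       (\<forall>p\<in>U.
          (vector [vector [a1 p + l p * e1 p, b1 p + l p * f1 p],
                   vector [a2 p + l p * e2 p, b2 p + l p * f2 p]] :: real^2^2)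
            *v vector [sin (\<theta> p), cos (\<theta> p)] = 0))"
proof -
  have "open U" and sc: "simply_connected U"
    using assms(1) by (simp_all add: simply_connected_domain_def)
  note smooth = framed_surface_smooth[OF \<open>open U\<close> assms(2)]
  have Delta: "(n p, s p) \<in> Delta" if "p \<in> U" for p
    using assms(2) that by (simp add: framed_surface_def)
  have tangency:
    "partial_u y p \<bullet> m = (a1 p + l p * e1 p) * (s p \<bullet> m) + (b1 p + l p * f1 p) * (frame_t n s p \<bullet> m)"
    "partial_v y p \<bullet> m = (a2 p + l p * e2 p) * (s p \<bullet> m) + (b2 p + l p * f2 p) * (frame_t n s p \<bullet> m)"
    if "p \<in> U" "smooth_on U l" "\<And>q. q \<in> U \<Longrightarrow> y q = x q + l q *\<^sub>R n q" "m \<bullet> n p = 0" for p l y m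
    using assms(3) \<open>p \<in> U\<close>
      partial_displaced[OF \<open>open U\<close> \<open>p \<in> U\<close> smooth(1,2) \<open>smooth_on U l\<close> that(3)]
    by (simp_all add: basic_invariants_def structure_equations_def tangency_row[OF \<open>m \<bullet> n p = 0\<close>])
  show ?thesis
    unfolding matrix_2_mult_eq_0_iff
  proof
    assume "bertrand_framed_surface Label_n Label_s U x n s"
    then obtain y m k l where fs: "framed_surface U y m k" and l: "smooth_on U l" "not_equiv_zero U l"
      and mate: "\<And>p. p \<in> U \<Longrightarrow> y p = x p + l p *\<^sub>R n p" "\<And>p. p \<in> U \<Longrightarrow> n p = k p"
      unfolding bertrand_framed_surface_def mates_def by auto
    have Delta': "(m p, n p) \<in> Delta" if "p \<in> U" for p
      using fs that by (simp add: framed_surface_def mate(2))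
    \<comment> \<open>In the frame \<open>s, t\<close> of the plane orthogonal to \<open>n\<close>, the mate normal \<open>m\<close> has polar angle
      measured from \<open>t\<close>, which is why \<open>s\<close> goes with the sine.\<close>
    obtain \<theta> where \<theta>: "smooth_on U \<theta>"
      "\<And>p. p \<in> U \<Longrightarrow> s p \<bullet> m p = sin (\<theta> p) \<and> frame_t n s p \<bullet> m p = cos (\<theta> p)"
    proof (rule smooth_angle[OF \<open>open U\<close> sc])
      show "smooth_on U (\<lambda>p. s p \<bullet> m p)" "smooth_on U (\<lambda>p. frame_t n s p \<bullet> m p)"
        by (intro smooth_on_inner smooth \<open>open U\<close> framed_surface_smooth[OF \<open>open U\<close> fs])+
      show "(s p \<bullet> m p)\<^sup>2 + (frame_t n s p \<bullet> m p)\<^sup>2 = 1" if "p \<in> U" for p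
        using Delta_coordinates_unit[OF Delta[OF that]] Delta_orthonormal[OF Delta'[OF that]]
        by (simp add: frame_t_def)
    qed blast
    have "(a1 p + l p * e1 p) * sin (\<theta> p) + (b1 p + l p * f1 p) * cos (\<theta> p) = 0 \<and>
          (a2 p + l p * e2 p) * sin (\<theta> p) + (b2 p + l p * f2 p) * cos (\<theta> p) = 0" if "p \<in> U" for p
    proof -
      have "m p \<bullet> n p = 0"
        using Delta_orthonormal(3)[OF Delta'[OF that]] .
      from tangency[OF that l(1) mate(1) this] \<theta>(2)[OF that] show ?thesis
        using fs that by (simp add: framed_surface_def)
    qed
    with l \<theta>(1) show "\<exists>l \<theta>. smooth_on U l \<and> smooth_on U \<theta> \<and> not_equiv_zero U l \<and>
      (\<forall>p\<in>U. (a1 p + l p * e1 p) * sin (\<theta> p) + (b1 p + l p * f1 p) * cos (\<theta> p) = 0 \<and>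
              (a2 p + l p * e2 p) * sin (\<theta> p) + (b2 p + l p * f2 p) * cos (\<theta> p) = 0)"
      by blast
  next
    assume "\<exists>l \<theta>. smooth_on U l \<and> smooth_on U \<theta> \<and> not_equiv_zero U l \<and>
      (\<forall>p\<in>U. (a1 p + l p * e1 p) * sin (\<theta> p) + (b1 p + l p * f1 p) * cos (\<theta> p) = 0 \<and>
              (a2 p + l p * e2 p) * sin (\<theta> p) + (b2 p + l p * f2 p) * cos (\<theta> p) = 0)"
    then obtain l \<theta> where l: "smooth_on U l" "not_equiv_zero U l" and \<theta>: "smooth_on U \<theta>"
      and eq: "\<And>p. p \<in> U \<Longrightarrow> (a1 p + l p * e1 p) * sin (\<theta> p) + (b1 p + l p * f1 p) * cos (\<theta> p) = 0"
        "\<And>p. p \<in> U \<Longrightarrow> (a2 p + l p * e2 p) * sin (\<theta> p) + (b2 p + l p * f2 p) * cos (\<theta> p) = 0"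
      by blast
    \<comment> \<open>The mate is \<open>(y, m, n)\<close>: the old normal becomes the second vector of the new frame.\<close>
    define y where "y p = x p + l p *\<^sub>R n p" for p
    define m where "m p = sin (\<theta> p) *\<^sub>R s p + cos (\<theta> p) *\<^sub>R frame_t n s p" for p
    have m: "s p \<bullet> m p = sin (\<theta> p)" "frame_t n s p \<bullet> m p = cos (\<theta> p)" "m p \<bullet> n p = 0"
      "m p \<bullet> m p = 1" if "p \<in> U" for p
    proof -
      note on = Delta_orthonormal[OF Delta[OF that], folded frame_t_def[of n s]]
      show st: "s p \<bullet> m p = sin (\<theta> p)" "frame_t n s p \<bullet> m p = cos (\<theta> p)" "m p \<bullet> n p = 0"
        using on by (simp_all add: m_def inner_add_left inner_add_right inner_commute)
      have "m p \<bullet> m p = sin (\<theta> p) * (s p \<bullet> m p) + cos (\<theta> p) * (frame_t n s p \<bullet> m p)"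
        by (subst m_def) (simp add: inner_add_left)
      then show "m p \<bullet> m p = 1"
        using sin_cos_squared_add[of "\<theta> p"] by (simp add: st power2_eq_square)
    qed
    have "framed_surface U y m n"
      unfolding framed_surface_def
    proof (intro conjI ballI)
      show "smooth_on U (\<lambda>p. (y p, m p, n p))"
        unfolding y_def m_def
        by (intro smooth_on_Pair smooth_on_add smooth_on_scaleR smooth smooth_on_sin_cos \<theta> l \<open>open U\<close>)
      show "(m p, n p) \<in> Delta" if "p \<in> U" for p
        using m[OF that] Delta_orthonormal(1)[OF Delta[OF that]]
        by (simp add: Delta_def norm_eq_1)
      show "partial_u y p \<bullet> m p = 0" "partial_v y p \<bullet> m p = 0" if "p \<in> U" for p
        using tangency[OF that l(1) _ m(3)[OF that]] eq[OF that] m[OF that]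
        by (simp_all add: y_def)
    qed
    moreover from this have "mates Label_n Label_s U x n s y m n"
      unfolding mates_def using l assms(2) by (auto simp: y_def)
    ultimately show "bertrand_framed_surface Label_n Label_s U x n s"
      unfolding bertrand_framed_surface_def by blast
  qed
qed

end
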